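(* Let $c\colon\mathbb{R}\times\mathbb{R}\to\mathbb{R}\cup\{+\infty\}$ be a cost with domain $D$ satisfying: (i) $D$ is a nonempty open convex proper subset of $\mathbb{R}\times\mathbb{R}$; (ii) $c$ is $\ominus$-monotone; (iii) for every $(x,y)\in D$ there is an open ball $\mathcal{B}_\delta(x,y)$ ($\delta>0$) such that $\sup_{(u,v)\in\mathcal{B}_\delta(x,y)}c(u,v)<+\infty$; (iv) for every $(x,y)$ in the boundary of $D$, $c(x_k,y_k)\to+\infty$ whenever $(x_k,y_k)\to(x,y)$. Let $G$ be a nonempty subset of $D$ such that: (v) $G$ is $c$-path bounded; (vi) for any partition $\{S_1,S_2\}$ of $G$, there are $(x,y)\in S_1$ and $(u,v)\in S_2$ that are strongly connected or unilaterally connected in $G$. Then $G$ has a strongly connected $c$-path bounded extension, namely $\widetilde G:=\operatorname{CE}_\ominus(\overline G)\cap D$, and $G$ is $c$-potentiable.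
   Context: $X=Y=\mathbb{R}$, $D:=\{(x,y)\in\mathbb{R}\times\mathbb{R}: c(x,y)<+\infty\}$. $\mathbb{R}\times\mathbb{R}$ carries the Euclidean norm; $\mathcal{B}_\delta(x,y)$ is the open ball of radius $\delta$ centered at $(x,y)$; $\overline G$ is the closure of $G$ in $\mathbb{R}^2$. Conventions: $r-(+\infty)=-\infty$ for $r\in\mathbb{R}$, $\sup\varnothing=-\infty$, $\inf\varnothing=+\infty$. Orders: $(x,y)\preccurlyeq^\ominus(u,v)$ iff $x\le u$ and $y\ge v$; $(x,y)\prec^\oplus(u,v)$ iff $x<u$ and $y<v$. $(S,\preccurlyeq^\ominus)$ is a chain if any two elements of $S\subseteq\mathbb{R}^2$ are comparable for $\preccurlyeq^\ominus$. $c$ is $\ominus$-monotone if for all $(x_s,y_s),(x_e,y_e)\in D$ with $(x_s,y_s)\prec^\oplus(x_e,y_e)$ or $(x_e,y_e)\prec^\oplus(x_s,y_s)$ one has $c(x_s,y_s)-c(x_e,y_s)+c(x_e,y_e)-c(x_s,y_e)>0$. Paths: for a nonempty $H\subseteq D$, a path in $H$ from $(x_s,y_s)\in H$ to $(x_e,y_e)\in H$ is a finite sequence $((x_k,y_k))_{k=1}^{N+1}$ in $H$ ($N\ge1$) with $(x_1,y_1)=(x_s,y_s)$, $(x_{N+1},y_{N+1})=(x_e,y_e)$ and $c(x_{k+1},y_k)<+\infty$ for $k\in\{1,\dots,N\}$. Two points of $H$ are strongly connected (in $H$) if there is a path in $H$ from each of them to the other; they are unilaterally connected if there is a path in exactly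 one of the two directions. $H$ is strongly connected if any two of its points are strongly connected in $H$. $F_H\big((x_s,y_s),(x_e,y_e)\big):=\sup\sum_{k=1}^N\big(c(x_k,y_k)-c(x_{k+1},y_k)\big)$ over all paths in $H$ from $(x_s,y_s)$ to $(x_e,y_e)$. $H$ is $c$-path bounded if $F_H<+\infty$ on $H\times H$. A $c$-path bounded extension of $G$ is a $c$-path bounded set $S\subseteq D$ with $G\subseteq S$. A partition $\{S_1,S_2\}$ of $G$ consists of two disjoint nonempty sets with union $G$. Chain extension: let $(H,\preccurlyeq^\ominus)$ be a chain. For $(x,y)\in H$ put $A^H_{(x,y)}:=\{(u,v)\in H:(x,y)\preccurlyeq^\ominus(u,v)\}$. If $H\setminus A^H_{(x,y)}\ne\varnothing$, let $L^H_{(x,y)}$ be the supremum of the first coordinates, and $U^H_{(x,y)}$ the infimum of the second coordinates, of the points of $H\setminus A^H_{(x,y)}$; otherwise let $L^H_{(x,y)}:=x$ and $U^H_{(x,y)}:=y$. Let $\mathcal{I}^H_{(x,y)}$ be the closed segment $\{(1-\lambda)(L^H_{(x,y)},U^H_{(x,y)})+\lambda(x,y):\lambda\in[0,1]\}$ and $\operatorname{CE}_\ominus(H):=\bigcup_{(x,y)\in H}\mathcal{I}^H_{(x,y)}$. (Under the hypotheses of the claim, $(\overline G,\preccurlyeq^\ominus)$ is a chain, so $\operatorname{CE}_\ominus(\overline G)$ is defined.) $c$-potentiability: for $\psi\colon X\to[-\infty,+\infty]$, $\psi^c(y):=\inf\{c(x,y)-\psi(x): (x,y)\in D\}$; for $\varphi\colon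 Y\to[-\infty,+\infty]$, $\varphi^{\overline c}(x):=\inf\{c(x,y)-\varphi(y):(x,y)\in D\}$. A $c$-class function is a $\psi\colon X\to[-\infty,+\infty]$ of the form $\psi=\varphi^{\overline c}$. $G$ is $c$-potentiable if there is a $c$-class function $\psi$ such that every $(x,y)\in G$ satisfies $\psi(x)\in\mathbb{R}$ and $\psi(x)+\psi^c(y)=c(x,y)<+\infty$. *)

theory Defs
  imports "HOL-Analysis.Analysis"
begin

definition cost_domain :: "(real \<times> real \<Rightarrow> ereal) \<Rightarrow> (real \<times> real) set" where
  "cost_domain c = {p. c p < \<infinity>}"

definition ominus_le :: "real \<times> real \<Rightarrow> real \<times> real \<Rightarrow> bool" where
  "ominus_le p q \<longleftrightarrow> fst p \<le> fst q \<and> snd p \<ge> snd q"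

definition oplus_less :: "real \<times> real \<Rightarrow> real \<times> real \<Rightarrow> bool" where
  "oplus_less p q \<longleftrightarrow> fst p < fst q \<and> snd p < snd q"

text \<open>The first and third costs below are finite, so when the second or the fourth one is
  infinite the whole expression is \<open>-\<infinity>\<close>.  Hence the inequality also forces
  the two mixed costs to be finite.\<close>

definition ominus_monotone :: "(real \<times> real \<Rightarrow> ereal) \<Rightarrow> bool" where
  "ominus_monotone c \<longleftrightarrow>
     (\<forall>x\<^sub>s y\<^sub>s x\<^sub>e y\<^sub>e. (x\<^sub>s, y\<^sub>s) \<in> cost_domain c \<longrightarrow> (x\<^sub>e, y\<^sub>e) \<in> cost_domain c \<longrightarrow>
        oplus_less (x\<^sub>s, y\<^sub>s) (x\<^sub>e, y\<^sub>e) \<or> oplus_less (x\<^sub>e, y\<^sub>e) (x\<^sub>s, y\<^sub>s) \<longrightarrow>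
        c (x\<^sub>s, y\<^sub>s) - c (x\<^sub>e, y\<^sub>s) + c (x\<^sub>e, y\<^sub>e) - c (x\<^sub>s, y\<^sub>e) > 0)"

text \<open>A path with \<open>N\<close> steps is a function on \<open>nat\<close> of which only the
  values at \<open>1, \<dots>, N + 1\<close> matter.\<close>

definition cost_path ::
  "(real \<times> real \<Rightarrow> ereal) \<Rightarrow> (real \<times> real) set \<Rightarrow> real \<times> real \<Rightarrow> real \<times> real \<Rightarrow>
     nat \<Rightarrow> (nat \<Rightarrow> real \<times> real) \<Rightarrow> bool" where
  "cost_path c H s e N p \<longleftrightarrow>
     N \<ge> 1 \<and> (\<forall>k\<in>{1..N+1}. p k \<in> H) \<and> p 1 = s \<and> p (N + 1) = e \<and>
     (\<forall>k\<in>{1..N}. c (fst (p (k + 1)), snd (p k)) < \<infinity>)"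

definition path_connects ::
  "(real \<times> real \<Rightarrow> ereal) \<Rightarrow> (real \<times> real) set \<Rightarrow> real \<times> real \<Rightarrow> real \<times> real \<Rightarrow> bool" where
  "path_connects c H s e \<longleftrightarrow> (\<exists>N p. cost_path c H s e N p)"

definition strongly_connected_in ::
  "(real \<times> real \<Rightarrow> ereal) \<Rightarrow> (real \<times> real) set \<Rightarrow> real \<times> real \<Rightarrow> real \<times> real \<Rightarrow> bool" where
  "strongly_connected_in c H a b \<longleftrightarrow> path_connects c H a b \<and> path_connects c H b a"

definition unilaterally_connected_in ::
  "(real \<times> real \<Rightarrow> ereal) \<Rightarrow> (real \<times> real) set \<Rightarrow> real \<times> real \<Rightarrow> real \<times> real \<Rightarrow> bool" where
  "unilaterally_connected_in c H a b \<longleftrightarrow>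
     (path_connects c H a b \<and> \<not> path_connects c H b a) \<or>
     (path_connects c H b a \<and> \<not> path_connects c H a b)"

definition strongly_connected_set ::
  "(real \<times> real \<Rightarrow> ereal) \<Rightarrow> (real \<times> real) set \<Rightarrow> bool" where
  "strongly_connected_set c H \<longleftrightarrow> (\<forall>a\<in>H. \<forall>b\<in>H. strongly_connected_in c H a b)"

definition path_sup ::
  "(real \<times> real \<Rightarrow> ereal) \<Rightarrow> (real \<times> real) set \<Rightarrow> real \<times> real \<Rightarrow> real \<times> real \<Rightarrow> ereal" where
  "path_sup c H s e =
     Sup {(\<Sum>k=1..N. c (p k) - c (fst (p (k + 1)), snd (p k))) | N p. cost_path c H s e N p}"

definition path_bounded :: "(real \<times> real \<Rightarrow> ereal) \<Rightarrow> (real \<times> real) set \<Rightarrow> bool" where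
  "path_bounded c H \<longleftrightarrow> (\<forall>s\<in>H. \<forall>e\<in>H. path_sup c H s e < \<infinity>)"

definition path_bounded_extension ::
  "(real \<times> real \<Rightarrow> ereal) \<Rightarrow> (real \<times> real) set \<Rightarrow> (real \<times> real) set \<Rightarrow> bool" where
  "path_bounded_extension c G S \<longleftrightarrow> S \<subseteq> cost_domain c \<and> G \<subseteq> S \<and> path_bounded c S"

definition upper_part :: "(real \<times> real) set \<Rightarrow> real \<times> real \<Rightarrow> (real \<times> real) set" where
  "upper_part H p = {q \<in> H. ominus_le p q}"

text \<open>If \<open>H\<close> is a chain for \<^term>\<open>ominus_le\<close> and \<open>p \<in> H\<close>, every point of
  \<open>H - upper_part H p\<close> precedes \<open>p\<close>.  The real supremum and infimum below are then
  taken over sets bounded by the coordinates of \<open>p\<close>; only this case is meaningful.\<close>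

definition chain_L :: "(real \<times> real) set \<Rightarrow> real \<times> real \<Rightarrow> real" where
  "chain_L H p =
     (if H - upper_part H p \<noteq> {} then Sup (fst ` (H - upper_part H p)) else fst p)"

definition chain_U :: "(real \<times> real) set \<Rightarrow> real \<times> real \<Rightarrow> real" where
  "chain_U H p =
     (if H - upper_part H p \<noteq> {} then Inf (snd ` (H - upper_part H p)) else snd p)"

definition chain_extension :: "(real \<times> real) set \<Rightarrow> (real \<times> real) set" where
  "chain_extension H = (\<Union>p\<in>H. closed_segment (chain_L H p, chain_U H p) p)"

definition c_transform ::
  "(real \<times> real \<Rightarrow> ereal) \<Rightarrow> (real \<Rightarrow> ereal) \<Rightarrow> real \<Rightarrow> ereal" where
  "c_transform c \<psi> y = Inf {c (x, y) - \<psi> x | x. (x, y) \<in> cost_domain c}"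

definition cbar_transform ::
  "(real \<times> real \<Rightarrow> ereal) \<Rightarrow> (real \<Rightarrow> ereal) \<Rightarrow> real \<Rightarrow> ereal" where
  "cbar_transform c \<phi> x = Inf {c (x, y) - \<phi> y | y. (x, y) \<in> cost_domain c}"

definition c_class :: "(real \<times> real \<Rightarrow> ereal) \<Rightarrow> (real \<Rightarrow> ereal) \<Rightarrow> bool" where
  "c_class c \<psi> \<longleftrightarrow> (\<exists>\<phi>. \<psi> = cbar_transform c \<phi>)"

definition potentiable :: "(real \<times> real \<Rightarrow> ereal) \<Rightarrow> (real \<times> real) set \<Rightarrow> bool" where
  "potentiable c G \<longleftrightarrow>
     (\<exists>\<psi>. c_class c \<psi> \<and>
        (\<forall>(x, y)\<in>G. \<bar>\<psi> x\<bar> \<noteq> \<infinity> \<and> \<psi> x + c_transform c \<psi> y = c (x, y) \<and> c (x, y) < \<infinity>))"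

end

theory Submission
  imports Defs
begin

text \<open>
  Write \<open>D\<close> for the domain of the cost and \<open>\<preceq>\<close> for \<^const>\<open>ominus_le\<close>.  The proof separates an
  order-theoretic part, driven by monotonicity of the cost, from a topological part,
  in which path boundedness of \<open>G\<close> keeps the closure of \<open>G\<close>, apart from its extreme points, away
  from the boundary of \<open>D\<close>.

  A path that returns to its start has weight at most \<open>0\<close> in a path bounded set, since otherwise
  repeating it would make the weights unbounded.  Two points with \<open>p \<prec>\<^sup>\<oplus> q\<close> would give such a path
  of positive weight, by monotonicity, so a path bounded set is a chain for \<open>\<preceq>\<close>
  (\<open>path_bounded_chain\<close>), and so is its closure.

  Conversely, a chain is cyclically monotone: cutting the last point of the
  chain out of its cycle does not raise the rearranged cost, because this is exactly an
  exchange along a rectangle, and one proceeds by induction (\<open>chain_cyclically_monotone\<close>).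
  Hence in a chain that is strongly connected, the weight of a path from \<open>s\<close> to \<open>e\<close> is bounded by minus the weight of any one
  fixed path back: strongly connected chains in \<open>D\<close> are path bounded.  Given this,
  the path supremum from a base point is finite everywhere and yields a potential, as in the
  classical argument of Rockafellar (\<open>potentiable_strongly_connected\<close>).  So everything
  reduces to strong connectedness of the extension.

  The function \<open>x - y\<close> identifies a chain with a set of reals, with a
  \<open>1\<close>-Lipschitz inverse, and the chain extension of a closed chain fills the gaps of this
  set.  So the extension of the closure of \<open>G\<close>, cut down to \<open>D\<close>, is topologically connected provided
  nothing is lost between two of its points.  Since \<open>D\<close> is convex, it is enough that a point \<open>k\<close> of
  the closure that lies between two points of \<open>G\<close> belongs to \<open>D\<close>
  (\<open>closure_point_between_in_domain\<close>).  If it did not, \<open>k\<close> would be a boundary point.  The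
  connection hypothesis gives a single step \<open>a \<rightarrow> b\<close> of a path in \<open>G\<close> that jumps over \<open>k\<close>, and
  this step could be broken at points \<open>g\<close> of \<open>G\<close> arbitrarily close to \<open>k\<close>: the weight of
  \<open>a \<rightarrow> g \<rightarrow> b\<close> contains \<open>c g\<close>, which tends to infinity, whereas the two mixed costs stay bounded above.  This
  contradicts path boundedness.  Finally, in an open domain nearby points are joined by steps
  in both directions, so connectedness implies strong connectedness
  (\<open>connected_imp_strongly_connected\<close>).
\<close>

section \<open>Weights of paths\<close>

definition path_weight ::
  "(real \<times> real \<Rightarrow> ereal) \<Rightarrow> nat \<Rightarrow> (nat \<Rightarrow> real \<times> real) \<Rightarrow> ereal" where
  "path_weight c N p = (\<Sum>k=1..N. c (p k) - c (fst (p (k + 1)), snd (p k)))"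

lemma path_sup_upper: "cost_path c H s e N p \<Longrightarrow> path_weight c N p \<le> path_sup c H s e"
  unfolding path_sup_def path_weight_def by (rule Sup_upper) blast

lemma path_sup_least:
  "(\<And>N p. cost_path c H s e N p \<Longrightarrow> path_weight c N p \<le> B) \<Longrightarrow> path_sup c H s e \<le> B"
  unfolding path_sup_def path_weight_def by (rule Sup_least) blast

lemma cost_path_points:
  assumes "cost_path c H s e N p" shows "s \<in> H" "e \<in> H"
  using assms unfolding cost_path_def by force+

lemma cost_path_edge:
  assumes "a \<in> H" "b \<in> H" "c (fst b, snd a) < \<infinity>"
  shows "cost_path c H a b 1 (\<lambda>k. if k = 1 then a else b)"
    and "path_weight c 1 (\<lambda>k. if k = 1 then a else b) = c a - c (fst b, snd a)"
  using assms by (auto simp: cost_path_def path_weight_def)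

lemma cost_path_append:
  assumes p: "cost_path c H a m N p" and q: "cost_path c H m b M q"
  obtains r where "cost_path c H a b (N + M) r"
    "path_weight c (N + M) r = path_weight c N p + path_weight c M q"
proof
  define r where "r = (\<lambda>k. if k \<le> N then p k else q (k - N))"
  have rp: "r k = p k" if "k \<le> N + 1" for k
    using p q that unfolding r_def cost_path_def by (cases "k = N + 1") auto
  have rq: "r (k + N) = q k" if "k \<ge> 1" for k
    using that unfolding r_def by auto
  have in_H: "r k \<in> H" if "k \<in> {1..N + M + 1}" for k
  proof (cases "k \<le> N + 1")
    case True
    then show ?thesis using p that rp unfolding cost_path_def by auto
  next
    case False
    then have "k - N \<in> {1..M + 1}" "k - N + N = k" using that by auto
    then show ?thesis using q rq[of "k - N"] unfolding cost_path_def by auto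
  qed
  have edge: "c (fst (r (k + 1)), snd (r k)) < \<infinity>" if "k \<in> {1..N + M}" for k
  proof (cases "k \<le> N")
    case True
    then show ?thesis using p that rp unfolding cost_path_def by auto
  next
    case False
    then have "k - N \<in> {1..M}" "k - N + N = k" "k - N + 1 + N = k + 1" using that by auto
    then show ?thesis using q rq[of "k - N"] rq[of "k - N + 1"] unfolding cost_path_def by auto
  qed
  have ends: "r 1 = a" "r (N + M + 1) = b"
    using p q rp[of 1] rq[of "M + 1"] unfolding cost_path_def by (auto simp: add_ac)
  have "N + M \<ge> 1" using p unfolding cost_path_def by auto
  then show "cost_path c H a b (N + M) r"
    unfolding cost_path_def using in_H edge ends by blast
  let ?w = "\<lambda>r k. c (r k) - c (fst (r (k + 1)), snd (r k))"
  have "path_weight c (N + M) r = (\<Sum>k=1..N. ?w r k) + (\<Sum>k=N+1..N+M. ?w r k)"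
    unfolding path_weight_def by (rule sum.ub_add_nat) auto
  also have "(\<Sum>k=N+1..N+M. ?w r k) = (\<Sum>k=1..M. ?w r (k + N))"
    using sum.shift_bounds_cl_nat_ivl[of "?w r" 1 N M] by (simp add: add_ac)
  also have "\<dots> = path_weight c M q"
    unfolding path_weight_def
  proof (rule sum.cong)
    fix k assume "k \<in> {1..M}"
    then show "?w r (k + N) = ?w q k" using rq[of k] rq[of "k + 1"] by (simp add: add_ac)
  qed simp
  also have "(\<Sum>k=1..N. ?w r k) = path_weight c N p"
    unfolding path_weight_def using rp by (intro sum.cong) auto
  finally show "path_weight c (N + M) r = path_weight c N p + path_weight c M q" .
qed

lemma path_connects_trans:
  "path_connects c H a m \<Longrightarrow> path_connects c H m b \<Longrightarrow> path_connects c H a b"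
  unfolding path_connects_def by (metis cost_path_append)

lemma path_weight_finite:
  assumes cost: "\<And>p. c p \<noteq> -\<infinity>" and H: "H \<subseteq> cost_domain c" and p: "cost_path c H s e N p"
  shows "\<bar>path_weight c N p\<bar> \<noteq> \<infinity>"
  unfolding path_weight_def
proof (subst sum_Inf, clarify)
  fix k assume k: "k \<in> {1..N}" and inf: "\<bar>c (p k) - c (fst (p (k + 1)), snd (p k))\<bar> = \<infinity>"
  have "c (p k) < \<infinity>" "c (fst (p (k + 1)), snd (p k)) < \<infinity>"
    using p H k unfolding cost_path_def cost_domain_def by auto
  with inf show False
    using cost[of "p k"] cost[of "(fst (p (k + 1)), snd (p k))"]
    by (cases "c (p k)"; cases "c (fst (p (k + 1)), snd (p k))") auto
qed

text \<open>
  Superadditivity of the path supremum along concatenation, in the form in which one of the two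
  pieces is a single path and hence has a finite weight that may be subtracted.
\<close>

lemma path_sup_add_weight:
  assumes "\<And>p. c p \<noteq> -\<infinity>" "H \<subseteq> cost_domain c" "cost_path c H m b M q"
  shows "path_sup c H a m + path_weight c M q \<le> path_sup c H a b"
proof -
  have fin: "\<bar>path_weight c M q\<bar> \<noteq> \<infinity>" by (rule path_weight_finite[OF assms])
  have "path_sup c H a m \<le> path_sup c H a b - path_weight c M q"
  proof (rule path_sup_least)
    fix N p assume "cost_path c H a m N p"
    then have "path_weight c N p + path_weight c M q \<le> path_sup c H a b"
      using assms(3) cost_path_append path_sup_upper by metis
    then show "path_weight c N p \<le> path_sup c H a b - path_weight c M q"
      using fin by (simp add: ereal_le_minus)
  qed
  then show ?thesis using fin by (simp add: ereal_le_minus)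
qed

text \<open>
  Appending the loop to a path from \<open>s\<close> to \<open>s\<close> again gives such a path, so the supremum \<open>F\<close> over
  these paths, which is finite as soon as the loop has positive weight \<open>w\<close>, would satisfy
  \<open>F + w \<le> F\<close>.
\<close>

lemma path_bounded_loop_le:
  assumes "\<And>p. c p \<noteq> -\<infinity>" "H \<subseteq> cost_domain c" "path_bounded c H"
    and loop: "cost_path c H s s N p"
  shows "path_weight c N p \<le> 0"
proof -
  have "path_sup c H s s < \<infinity>"
    using assms(3) cost_path_points[OF loop] unfolding path_bounded_def by blast
  moreover have "path_weight c N p \<le> path_sup c H s s" by (rule path_sup_upper[OF loop])
  moreover have "path_sup c H s s + path_weight c N p \<le> path_sup c H s s"
    by (rule path_sup_add_weight[OF assms(1,2) loop])
  moreover have "\<bar>path_weight c N p\<bar> \<noteq> \<infinity>" by (rule path_weight_finite[OF assms(1,2) loop])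
  ultimately show ?thesis
    by (cases "path_sup c H s s"; cases "path_weight c N p") auto
qed

section \<open>Chains and cyclical monotonicity\<close>

text \<open>
  Monotonicity, rewritten as an inequality between sums, extends to degenerate rectangles and to
  infinite costs at the corners on the right.
\<close>

lemma ominus_monotone_exchange:
  assumes "ominus_monotone c" "x1 \<le> x2" "y1 \<le> y2" and cost: "\<And>p. c p \<noteq> -\<infinity>"
  shows "c (x1, y2) + c (x2, y1) \<le> c (x1, y1) + c (x2, y2)"
proof (cases "x1 = x2 \<or> y1 = y2 \<or> c (x1, y1) = \<infinity> \<or> c (x2, y2) = \<infinity>")
  case True
  then show ?thesis by (auto simp: add.commute)
next
  case False
  then have "c (x1, y1) - c (x2, y1) + c (x2, y2) - c (x1, y2) > 0"
    using assms unfolding ominus_monotone_def oplus_less_def cost_domain_def by auto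
  then show ?thesis
    using cost[of "(x1, y1)"] cost[of "(x2, y1)"] cost[of "(x2, y2)"] cost[of "(x1, y2)"] False
    by (cases "c (x1, y1)"; cases "c (x2, y1)"; cases "c (x2, y2)"; cases "c (x1, y2)") auto
qed

text \<open>
  The strictly increasing coordinate \<open>x - y\<close> parametrises every chain, and the inverse
  of this parametrisation is \<open>1\<close>-Lipschitz.
\<close>

definition chain_coord :: "real \<times> real \<Rightarrow> real" where
  "chain_coord p = fst p - snd p"

lemma chain_coord_mono: "ominus_le p q \<Longrightarrow> chain_coord p \<le> chain_coord q"
  unfolding ominus_le_def chain_coord_def by auto

lemma ominus_le_chain_coord:
  assumes "Complete_Partial_Order.chain ominus_le S" "p \<in> S" "q \<in> S" "chain_coord p \<le> chain_coord q"
  shows "ominus_le p q"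
  using chainD[OF assms(1-3)] assms(4) unfolding ominus_le_def chain_coord_def by auto

lemma chain_coord_inj:
  assumes "Complete_Partial_Order.chain ominus_le S" "p \<in> S" "q \<in> S" "chain_coord p = chain_coord q"
  shows "p = q"
  using chainD[OF assms(1-3)] assms(4) unfolding ominus_le_def chain_coord_def
  by (auto simp: prod_eq_iff)

lemma ominus_le_dist:
  assumes "ominus_le p q"
  shows "dist p q \<le> chain_coord q - chain_coord p"
proof -
  have "dist p q \<le> \<bar>fst p - fst q\<bar> + \<bar>snd p - snd q\<bar>"
    unfolding dist_prod_def dist_real_def
    using sqrt_sum_squares_le_sum_abs[of "\<bar>fst p - fst q\<bar>" "\<bar>snd p - snd q\<bar>"] by simp
  then show ?thesis using assms unfolding ominus_le_def chain_coord_def by auto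
qed

text \<open>
  Induction on the number of points.  Let \<open>m\<close> be the index of the last point of the chain, with
  \<open>\<sigma> a = m\<close>.  Redirecting \<open>a\<close> to \<open>\<sigma> m\<close> and fixing \<open>m\<close> changes the right-hand side by
  an exchange on the rectangle whose lower right corner is the last point; this does not increase
  it, and it leaves a permutation of the other indices.
\<close>

lemma chain_cyclically_monotone:
  assumes cost: "\<And>p. c p \<noteq> -\<infinity>" and monotone: "ominus_monotone c"
    and "finite I" "\<sigma> permutes I" "Complete_Partial_Order.chain ominus_le (f ` I)"
  shows "(\<Sum>i\<in>I. c (f i)) \<le> (\<Sum>i\<in>I. c (fst (f (\<sigma> i)), snd (f i)))"
  using assms(3-5)
proof (induction I arbitrary: \<sigma> rule: finite_psubset_induct)
  case (psubset I)
  show ?case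
  proof (cases "I = {}")
    case False
    have "Max ((\<lambda>i. chain_coord (f i)) ` I) \<in> (\<lambda>i. chain_coord (f i)) ` I"
      using False psubset.hyps by (intro Max_in) auto
    then obtain m where m: "m \<in> I"
      and m_Max: "chain_coord (f m) = Max ((\<lambda>i. chain_coord (f i)) ` I)"
      by auto
    have m_max: "chain_coord (f i) \<le> chain_coord (f m)" if "i \<in> I" for i
      unfolding m_Max using that psubset.hyps by (intro Max_ge) auto
    have m_last: "ominus_le (f i) (f m)" if "i \<in> I" for i
      using ominus_le_chain_coord[OF psubset.prems(2)] m m_max that by blast
    \<comment> \<open>\<open>\<tau>\<close> is \<open>\<sigma>\<close> with \<open>m\<close> cut out of its cycle.\<close>
    define \<tau> where "\<tau> = Transposition.transpose m (\<sigma> m) \<circ> \<sigma>"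
    have \<sigma>m: "\<sigma> m \<in> I" using psubset.prems(1) m by (simp add: permutes_in_image)
    have "\<tau> permutes I"
      unfolding \<tau>_def using psubset.prems(1) m \<sigma>m by (intro permutes_compose permutes_swap_id)
    then have \<tau>: "\<tau> permutes (I - {m})"
      by (rule permutes_superset) (auto simp: \<tau>_def)
    have IH: "(\<Sum>i\<in>I - {m}. c (f i)) \<le> (\<Sum>i\<in>I - {m}. c (fst (f (\<tau> i)), snd (f i)))"
      using m psubset.prems(2) by (intro psubset.IH \<tau> chain_subset[OF psubset.prems(2)]) auto
    obtain a where a: "\<sigma> a = m" "a \<in> I"
      using psubset.prems(1) m by (metis permutes_def)
    have inj: "inj \<sigma>" using psubset.prems(1) by (rule permutes_inj)
    have \<tau>_eq: "\<tau> i = \<sigma> i" if "i \<noteq> m" "i \<noteq> a" for i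
      unfolding \<tau>_def using that a inj by (auto simp: Transposition.transpose_def dest: injD)
    show ?thesis
    proof (cases "a = m")
      case True
      have "(\<Sum>i\<in>I. c (f i)) = c (f m) + (\<Sum>i\<in>I - {m}. c (f i))"
        using m psubset.hyps by (simp add: sum.remove)
      also have "\<dots> \<le> c (f m) + (\<Sum>i\<in>I - {m}. c (fst (f (\<tau> i)), snd (f i)))"
        by (intro add_left_mono IH)
      also have "\<dots> = c (f m) + (\<Sum>i\<in>I - {m}. c (fst (f (\<sigma> i)), snd (f i)))"
        using \<tau>_eq True by (intro arg_cong2[where f = "(+)"] sum.cong) auto
      also have "\<dots> = (\<Sum>i\<in>I. c (fst (f (\<sigma> i)), snd (f i)))"
        using m psubset.hyps a True by (simp add: sum.remove)
      finally show ?thesis .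
    next
      case False
      let ?R = "\<Sum>i\<in>I - {m} - {a}. c (fst (f (\<sigma> i)), snd (f i))"
      have \<tau>a: "\<tau> a = \<sigma> m" unfolding \<tau>_def using a by simp
      have "(\<Sum>i\<in>I. c (f i)) = c (f m) + (\<Sum>i\<in>I - {m}. c (f i))"
        using m psubset.hyps by (simp add: sum.remove)
      also have "\<dots> \<le> c (f m) + (\<Sum>i\<in>I - {m}. c (fst (f (\<tau> i)), snd (f i)))"
        by (intro add_left_mono IH)
      also have "(\<Sum>i\<in>I - {m}. c (fst (f (\<tau> i)), snd (f i))) = c (fst (f (\<sigma> m)), snd (f a)) + 
          (\<Sum>i\<in>I - {m} - {a}. c (fst (f (\<tau> i)), snd (f i)))"
        using a False psubset.hyps \<tau>a by (simp add: sum.remove[of _ a])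
      also have "(\<Sum>i\<in>I - {m} - {a}. c (fst (f (\<tau> i)), snd (f i))) = ?R"
        using \<tau>_eq by (intro sum.cong) auto
      also have "c (f m) + (c (fst (f (\<sigma> m)), snd (f a)) + ?R) =
          (c (fst (f (\<sigma> m)), snd (f a)) + c (fst (f m), snd (f m))) + ?R"
        by (simp add: ac_simps)
      also have "\<dots> \<le> (c (fst (f (\<sigma> m)), snd (f m)) + c (fst (f m), snd (f a))) + ?R"
        using m_last[OF \<sigma>m] m_last[OF a(2)]
        by (intro add_right_mono ominus_monotone_exchange[OF monotone _ _ cost]) (auto simp: ominus_le_def)
      also have "\<dots> = (\<Sum>i\<in>I. c (fst (f (\<sigma> i)), snd (f i)))"
        using m psubset.hyps a False by (simp add: sum.remove[of I m] sum.remove[of "I - {m}" a] ac_simps)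
      finally show ?thesis .
    qed
  qed simp
qed

text \<open>A loop in a chain is cyclical monotonicity for the permutation that shifts its indices.\<close>

lemma chain_loop_weight_le:
  assumes cost: "\<And>p. c p \<noteq> -\<infinity>" and monotone: "ominus_monotone c"
    and H: "H \<subseteq> cost_domain c" and chain: "Complete_Partial_Order.chain ominus_le H"
    and loop: "cost_path c H s s N p"
  shows "path_weight c N p \<le> 0"
proof -
  define \<sigma> where "\<sigma> k = (if k \<in> {1..N} then if k = N then 1 else k + 1 else k)" for k
  have "inj_on \<sigma> {1..N}"
  proof (rule inj_onI)
    fix i j assume "i \<in> {1..N}" "j \<in> {1..N}" "\<sigma> i = \<sigma> j"
    then show "i = j" unfolding \<sigma>_def by (cases "i = N"; cases "j = N") auto
  qed
  moreover have "\<sigma> ` {1..N} \<subseteq> {1..N}" unfolding \<sigma>_def by auto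
  ultimately have "bij_betw \<sigma> {1..N} {1..N}"
    by (simp add: bij_betw_def endo_inj_surj)
  then have \<sigma>: "\<sigma> permutes {1..N}"
    by (rule bij_imp_permutes) (auto simp: \<sigma>_def)
  have "p ` {1..N} \<subseteq> H" using loop unfolding cost_path_def by auto
  then have "(\<Sum>k=1..N. c (p k)) \<le> (\<Sum>k=1..N. c (fst (p (\<sigma> k)), snd (p k)))"
    using chain_cyclically_monotone[OF cost monotone _ \<sigma>] chain_subset[OF chain] by blast
  also have "\<dots> = (\<Sum>k=1..N. c (fst (p (k + 1)), snd (p k)))"
    using loop unfolding \<sigma>_def cost_path_def by (intro sum.cong) auto
  finally have le: "(\<Sum>k=1..N. c (p k)) \<le> (\<Sum>k=1..N. c (fst (p (k + 1)), snd (p k)))" .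
  define r where "r q = real_of_ereal (c q)" for q
  have r: "c q = ereal (r q)" if "c q < \<infinity>" for q
    using that cost[of q] unfolding r_def by (cases "c q") auto
  have 1: "c (p k) = ereal (r (p k))" if "k \<in> {1..N}" for k
    using loop that H unfolding cost_path_def cost_domain_def by (intro r) auto
  have 2: "c (fst (p (k + 1)), snd (p k)) = ereal (r (fst (p (k + 1)), snd (p k)))" if "k \<in> {1..N}" for k
    using loop that unfolding cost_path_def by (intro r) auto
  have "path_weight c N p = (\<Sum>k=1..N. ereal (r (p k) - r (fst (p (k + 1)), snd (p k))))"
    unfolding path_weight_def using 1 2 by (intro sum.cong) auto
  moreover have "(\<Sum>k=1..N. c (p k)) = (\<Sum>k=1..N. ereal (r (p k)))"
    using 1 by (intro sum.cong) auto
  moreover have "(\<Sum>k=1..N. c (fst (p (k + 1)), snd (p k))) = (\<Sum>k=1..N. ereal (r (fst (p (k + 1)), snd (p k))))"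
    using 2 by (intro sum.cong) auto
  ultimately show ?thesis using le by (simp add: sum_subtractf)
qed

text \<open>Closing every path from \<open>s\<close> to \<open>e\<close> by one fixed path back bounds all their weights at once.\<close>

lemma strongly_connected_chain_path_bounded:
  assumes cost: "\<And>p. c p \<noteq> -\<infinity>" and monotone: "ominus_monotone c"
    and H: "H \<subseteq> cost_domain c" and chain: "Complete_Partial_Order.chain ominus_le H"
    and conn: "strongly_connected_set c H"
  shows "path_bounded c H"
  unfolding path_bounded_def
proof (intro ballI)
  fix s e assume "s \<in> H" "e \<in> H"
  then obtain M q where q: "cost_path c H e s M q"
    using conn unfolding strongly_connected_set_def strongly_connected_in_def path_connects_def by blast
  have fin: "\<bar>path_weight c M q\<bar> \<noteq> \<infinity>" using path_weight_finite[OF cost H q] .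
  have "path_sup c H s e \<le> - path_weight c M q"
  proof (rule path_sup_least)
    fix N p assume "cost_path c H s e N p"
    then obtain r where "cost_path c H s s (N + M) r"
      "path_weight c (N + M) r = path_weight c N p + path_weight c M q"
      using q cost_path_append by blast
    then have "path_weight c N p + path_weight c M q \<le> 0"
      using chain_loop_weight_le[OF cost monotone H chain] by metis
    then show "path_weight c N p \<le> - path_weight c M q"
      using fin by (cases "path_weight c N p"; cases "path_weight c M q") auto
  qed
  also have "\<dots> < \<infinity>" using fin by auto
  finally show "path_sup c H s e < \<infinity>" .
qed

text \<open>
  Points that are not comparable are strictly ordered in both coordinates, and then going forth
  and back between them is a loop of positive weight.
\<close>

lemma path_bounded_chain:
  assumes cost: "\<And>p. c p \<noteq> -\<infinity>" and monotone: "ominus_monotone c"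
    and H: "H \<subseteq> cost_domain c" and bounded: "path_bounded c H"
  shows "Complete_Partial_Order.chain ominus_le H"
proof -
  have no_less: False if p: "p \<in> H" and q: "q \<in> H" and less: "oplus_less p q" for p q
  proof -
    have gt: "c p - c (fst q, snd p) + c q - c (fst p, snd q) > 0"
      using monotone[unfolded ominus_monotone_def, rule_format, of "fst p" "snd p" "fst q" "snd q"]
        p q H less by auto
    have "c p < \<infinity>" "c q < \<infinity>" using p q H unfolding cost_domain_def by auto
    then obtain cp cq where cpq: "c p = ereal cp" "c q = ereal cq"
      using cost[of p] cost[of q] by (cases "c p"; cases "c q") auto
    have "c (fst q, snd p) < \<infinity> \<and> c (fst p, snd q) < \<infinity> \<and>
        0 < (c p - c (fst q, snd p)) + (c q - c (fst p, snd q))"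
      using gt cost[of "(fst q, snd p)"] cost[of "(fst p, snd q)"] unfolding cpq
      by (cases "c (fst q, snd p)"; cases "c (fst p, snd q)") auto
    then have fin: "c (fst q, snd p) < \<infinity>" "c (fst p, snd q) < \<infinity>"
      and gt': "0 < (c p - c (fst q, snd p)) + (c q - c (fst p, snd q))" by auto
    note forth_step = cost_path_edge[where c = c, OF p q fin(1)]
    note back_step = cost_path_edge[where c = c, OF q p fin(2)]
    obtain N r where "cost_path c H p p N r"
      "path_weight c N r = (c p - c (fst q, snd p)) + (c q - c (fst p, snd q))"
      using cost_path_append[OF forth_step(1) back_step(1)] forth_step(2) back_step(2) by metis
    then show False using path_bounded_loop_le[OF cost H bounded] gt' by fastforce
  qed
  show ?thesis
  proof (rule chainI)
    fix p q assume "p \<in> H" "q \<in> H"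
    then show "ominus_le p q \<or> ominus_le q p"
      using no_less[of p q] no_less[of q p] unfolding ominus_le_def oplus_less_def by force
  qed
qed

lemma chain_closure:
  assumes "Complete_Partial_Order.chain ominus_le S"
  shows "Complete_Partial_Order.chain ominus_le (closure S)"
proof (rule chainI)
  fix p q assume "p \<in> closure S" "q \<in> closure S"
  then have pq: "(p, q) \<in> closure (S \<times> S)" by (simp add: closure_Times)
  let ?C = "{z. fst (fst z) \<le> fst (snd z) \<and> snd (fst z) \<ge> snd (snd z)} \<union>
    {z. fst (snd z) \<le> fst (fst z) \<and> snd (snd z) \<ge> snd (fst z)} :: ((real \<times> real) \<times> (real \<times> real)) set"
  have "closed ?C"
    by (intro closed_Un closed_Collect_conj closed_Collect_le continuous_intros)
  moreover have "S \<times> S \<subseteq> ?C"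
    using chainD[OF assms] unfolding ominus_le_def by fastforce
  ultimately have "(p, q) \<in> ?C" using pq closure_minimal by blast
  then show "ominus_le p q \<or> ominus_le q p" unfolding ominus_le_def by auto
qed

section \<open>Potentials from path suprema\<close>

text \<open>
  The potential is minus the path supremum \<open>F\<close> from a base point.  Two points of \<open>H\<close> with the same
  second coordinate \<open>y\<close> can be exchanged by a step of weight \<open>c q - c p\<close>, which makes
  \<open>c q + F q\<close> a function \<open>\<phi> y\<close>; the step inequality for \<open>F\<close> then says precisely that the
  infimum defining the transform of \<open>\<phi>\<close> at \<open>x\<close> is attained at the points of \<open>H\<close> above \<open>x\<close>.
\<close>

lemma potentiable_strongly_connected:
  assumes cost: "\<And>p. c p \<noteq> -\<infinity>" and H: "H \<subseteq> cost_domain c"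
    and bounded: "path_bounded c H" and conn: "strongly_connected_set c H"
  shows "potentiable c H"
proof (cases "H = {}")
  case True
  then show ?thesis unfolding potentiable_def c_class_def by auto
next
  case False
  then obtain base where base: "base \<in> H" by blast
  define F where "F q = path_sup c H base q" for q
  define r where "r q = real_of_ereal (c q)" for q
  define f where "f q = real_of_ereal (F q)" for q
  have c_eq: "c q = ereal (r q)" if "q \<in> cost_domain c" for q
    using that cost[of q] unfolding cost_domain_def r_def by (cases "c q") auto
  have c_eq_H: "c q = ereal (r q)" if "q \<in> H" for q
    by (rule c_eq[OF subsetD[OF H that]])
  have F_eq: "F q = ereal (f q)" if q: "q \<in> H" for q
  proof -
    have "path_connects c H base q"
      using conn base q unfolding strongly_connected_set_def strongly_connected_in_def by blast
    then obtain N p where p: "cost_path c H base q N p" unfolding path_connects_def by blast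
    have "path_weight c N p \<le> F q" unfolding F_def by (rule path_sup_upper[OF p])
    moreover have "F q < \<infinity>" using bounded base q unfolding F_def path_bounded_def by blast
    ultimately have "\<bar>F q\<bar> \<noteq> \<infinity>" using path_weight_finite[OF cost H p] by auto
    then show ?thesis unfolding f_def by (cases "F q") auto
  qed
  have F_step: "F q + (c q - c (fst p, snd q)) \<le> F p"
    if "p \<in> H" "q \<in> H" "(fst p, snd q) \<in> cost_domain c" for p q
  proof -
    have fin: "c (fst p, snd q) < \<infinity>" using that unfolding cost_domain_def by auto
    show ?thesis
      using path_sup_add_weight[OF cost H cost_path_edge(1)[where c = c, OF that(2,1) fin], of base]
        cost_path_edge(2)[where c = c, OF that(2,1) fin] unfolding F_def by simp
  qed
  \<comment> \<open>Off the projection of \<open>H\<close> the supremum is empty, so that \<open>\<phi> = -\<infinity>\<close> and such points do not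
    constrain \<open>\<psi>\<close>.\<close>
  define \<phi> where "\<phi> y = (SUP q\<in>{q\<in>H. snd q = y}. c q + F q)" for y
  define \<psi> where "\<psi> = cbar_transform c \<phi>"
  have \<phi>: "\<phi> (snd q) = c q + F q" if q: "q \<in> H" for q
    unfolding \<phi>_def
  proof (rule antisym[OF SUP_least SUP_upper])
    fix p assume "p \<in> {p \<in> H. snd p = snd q}"
    then have p: "p \<in> H" "snd p = snd q" by auto
    then have "F p + (c p - c q) \<le> F q"
      using F_step[of q p] q H p(1) unfolding p(2) by auto
    then show "c p + F p \<le> c q + F q"
      by (simp add: F_eq[OF q] F_eq[OF p(1)] c_eq_H[OF q] c_eq_H[OF p(1)])
  qed (use q in auto)
  have \<psi>: "\<psi> (fst q) = - F q" if q: "q \<in> H" for q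
    unfolding \<psi>_def cbar_transform_def
  proof (rule antisym[OF Inf_lower2 Inf_greatest])
    show "c q - \<phi> (snd q) \<in> {c (fst q, y) - \<phi> y |y. (fst q, y) \<in> cost_domain c}"
      using q H by (intro CollectI exI[of _ "snd q"]) auto
    show "c q - \<phi> (snd q) \<le> - F q"
      by (simp add: \<phi>[OF q] F_eq[OF q] c_eq_H[OF q])
  next
    fix z assume "z \<in> {c (fst q, y) - \<phi> y |y. (fst q, y) \<in> cost_domain c}"
    then obtain y where z: "z = c (fst q, y) - \<phi> y" and y: "(fst q, y) \<in> cost_domain c" by blast
    show "- F q \<le> z"
    proof (cases "\<exists>p\<in>H. snd p = y")
      case True
      then obtain p where p: "p \<in> H" "y = snd p" by blast
      have "F p + (c p - c (fst q, snd p)) \<le> F q" using F_step[of q p] q p y by blast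
      then show ?thesis
        by (simp add: z p(2) \<phi>[OF p(1)] F_eq[OF q] F_eq[OF p(1)] c_eq_H[OF p(1)] c_eq[OF y[unfolded p(2)]])
    next
      case False
      then have none: "{q \<in> H. snd q = y} = {}" by blast
      have "\<phi> y = -\<infinity>" unfolding \<phi>_def none by (simp add: bot_ereal_def)
      then show ?thesis by (simp add: z c_eq[OF y])
    qed
  qed
  have \<psi>c: "c_transform c \<psi> (snd q) = \<phi> (snd q)" if q: "q \<in> H" for q
    unfolding c_transform_def
  proof (rule antisym[OF Inf_lower2 Inf_greatest])
    show "c q - \<psi> (fst q) \<in> {c (x, snd q) - \<psi> x |x. (x, snd q) \<in> cost_domain c}"
      using q H by (intro CollectI exI[of _ "fst q"]) auto
    show "c q - \<psi> (fst q) \<le> \<phi> (snd q)"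
      by (simp add: \<phi>[OF q] \<psi>[OF q] F_eq[OF q] c_eq_H[OF q])
  next
    fix z assume "z \<in> {c (x, snd q) - \<psi> x |x. (x, snd q) \<in> cost_domain c}"
    then obtain x where z: "z = c (x, snd q) - \<psi> x" and x: "(x, snd q) \<in> cost_domain c" by blast
    have "\<psi> x \<le> c (x, snd q) - \<phi> (snd q)"
      unfolding \<psi>_def cbar_transform_def using x by (intro Inf_lower) blast
    then show "\<phi> (snd q) \<le> z"
      unfolding z by (cases "\<psi> x") (simp_all add: c_eq[OF x] \<phi>[OF q] F_eq[OF q] c_eq_H[OF q])
  qed
  have "\<bar>\<psi> (fst q)\<bar> \<noteq> \<infinity> \<and> \<psi> (fst q) + c_transform c \<psi> (snd q) = c q \<and> c q < \<infinity>" if q: "q \<in> H" for q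
    by (simp add: \<psi>c[OF q] \<phi>[OF q] \<psi>[OF q] F_eq[OF q] c_eq_H[OF q])
  note potential = this
  show ?thesis unfolding potentiable_def
  proof (intro exI conjI ballI)
    show "c_class c \<psi>" unfolding c_class_def \<psi>_def by blast
    fix q assume "q \<in> H"
    from potential[OF this] show "case q of (x, y) \<Rightarrow>
        \<bar>\<psi> x\<bar> \<noteq> \<infinity> \<and> \<psi> x + c_transform c \<psi> y = c (x, y) \<and> c (x, y) < \<infinity>"
      by (simp add: case_prod_beta)
  qed
qed

lemma potentiable_subset:
  assumes "potentiable c H" "G \<subseteq> H"
  shows "potentiable c G"
proof -
  from assms(1) obtain \<psi> where \<psi>: "c_class c \<psi>"
    "\<forall>(x, y)\<in>H. \<bar>\<psi> x\<bar> \<noteq> \<infinity> \<and> \<psi> x + c_transform c \<psi> y = c (x, y) \<and> c (x, y) < \<infinity>"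
    unfolding potentiable_def by (elim exE conjE) (rule that; assumption)
  show ?thesis
    unfolding potentiable_def
    by (intro exI[of _ \<psi>] conjI \<psi>(1) ballI) (rule bspec[OF \<psi>(2) subsetD[OF assms(2)]])
qed

section \<open>The chain extension\<close>

text \<open>
  The two coordinates of the lower end of the segment at \<open>p\<close> are computed separately, as a supremum
  and as an infimum.  In a chain they are approached simultaneously, by the larger of two
  approximating points, so this end is a limit of points below \<open>p\<close>.
\<close>

lemma chain_gap:
  assumes chain: "Complete_Partial_Order.chain ominus_le H" and "closed H" "p \<in> H"
  shows "(chain_L H p, chain_U H p) \<in> H"
    and "ominus_le (chain_L H p, chain_U H p) p"
    and "q \<in> H \<Longrightarrow> \<not> ominus_le p q \<Longrightarrow> ominus_le q (chain_L H p, chain_U H p)"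
    and "H - upper_part H p \<noteq> {} \<Longrightarrow>
      (chain_L H p, chain_U H p) \<in> closure (H - upper_part H p)"
proof -
  define B where "B = H - upper_part H p"
  let ?g = "(chain_L H p, chain_U H p)"
  have B: "q \<in> B \<longleftrightarrow> q \<in> H \<and> \<not> ominus_le p q" for q
    unfolding B_def upper_part_def by auto
  have below: "ominus_le q p" if "q \<in> B" for q
    using that chainD[OF chain _ \<open>p \<in> H\<close>] B by blast
  have bdd: "bdd_above (fst ` B)" "bdd_below (snd ` B)"
    using below unfolding ominus_le_def by (auto intro!: bdd_aboveI bdd_belowI)
  have up: "ominus_le q ?g" if "q \<in> B" for q
    using that bdd unfolding chain_L_def chain_U_def ominus_le_def B_def[symmetric]
    by (auto intro!: cSup_upper cInf_lower)
  then show "q \<in> H \<Longrightarrow> \<not> ominus_le p q \<Longrightarrow> ominus_le q ?g" using B by blast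
  show g_le: "ominus_le ?g p"
    using below unfolding chain_L_def chain_U_def ominus_le_def B_def[symmetric]
    by (auto intro!: cSup_least cInf_greatest)
  show clo: "?g \<in> closure (H - upper_part H p)" if "H - upper_part H p \<noteq> {}"
    unfolding B_def[symmetric] closure_approachable
  proof (intro allI impI)
    fix e :: real assume "e > 0"
    have "\<exists>z\<in>fst ` B. Sup (fst ` B) - e / 2 < z"
      using \<open>e > 0\<close> that B_def by (intro less_cSupD) auto
    then obtain q1 where q1: "q1 \<in> B" "Sup (fst ` B) - e / 2 < fst q1" by blast
    have "\<exists>z\<in>snd ` B. z < Inf (snd ` B) + e / 2"
      using \<open>e > 0\<close> that B_def by (intro cInf_lessD) auto
    then obtain q2 where q2: "q2 \<in> B" "snd q2 < Inf (snd ` B) + e / 2" by blast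
    obtain r where r: "r \<in> B" "ominus_le q1 r" "ominus_le q2 r"
      using chainD[OF chain, of q1 q2] q1(1) q2(1) B unfolding ominus_le_def by blast
    have g: "?g = (Sup (fst ` B), Inf (snd ` B))"
      using that unfolding chain_L_def chain_U_def B_def by simp
    have "dist r ?g \<le> chain_coord ?g - chain_coord r"
      by (rule ominus_le_dist[OF up[OF r(1)]])
    also have "\<dots> < e"
      using q1(2) q2(2) r(2,3) unfolding g chain_coord_def ominus_le_def by auto
    finally show "\<exists>y\<in>B. dist y ?g < e" using r(1) by blast
  qed
  show g_H: "?g \<in> H"
  proof (cases "B = {}")
    case True
    then show ?thesis using \<open>p \<in> H\<close> unfolding chain_L_def chain_U_def B_def by simp
  next
    case False
    then show ?thesis using clo closure_minimal[OF _ \<open>closed H\<close>, of B] unfolding B_def by blast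
  qed
qed

lemma ominus_le_trans: "ominus_le p q \<Longrightarrow> ominus_le q r \<Longrightarrow> ominus_le p r"
  unfolding ominus_le_def by auto

lemma ominus_le_antisym: "ominus_le p q \<Longrightarrow> ominus_le q p \<Longrightarrow> p = q"
  unfolding ominus_le_def by (auto simp: prod_eq_iff)

lemma convex_between_coords:
  fixes a b t :: real
  shows "0 \<le> t \<Longrightarrow> t \<le> 1 \<Longrightarrow> a \<le> b \<Longrightarrow> a \<le> (1 - t) * a + t * b \<and> (1 - t) * a + t * b \<le> b"
  using mult_left_mono[of a b "t"] mult_left_mono[of a b "1 - t"] by (auto simp: algebra_simps)

lemma ominus_le_segment:
  assumes "ominus_le g p" "u \<in> closed_segment g p"
  shows "ominus_le g u" "ominus_le u p"
proof -
  obtain t where "0 \<le> t" "t \<le> 1" "u = (1 - t) *\<^sub>R g + t *\<^sub>R p"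
    using assms(2) unfolding closed_segment_def by blast
  then show "ominus_le g u" "ominus_le u p"
    using assms(1) convex_between_coords[of t "fst g" "fst p"] convex_between_coords[of t "- snd g" "- snd p"]
    unfolding ominus_le_def by auto
qed

lemma chain_closed_segment:
  assumes "ominus_le g p" "u \<in> closed_segment g p" "v \<in> closed_segment g p"
  shows "ominus_le u v \<or> ominus_le v u"
proof -
  obtain s t where st: "0 \<le> s" "s \<le> 1" "u = (1 - s) *\<^sub>R g + s *\<^sub>R p"
    "0 \<le> t" "t \<le> 1" "v = (1 - t) *\<^sub>R g + t *\<^sub>R p"
    using assms(2,3) unfolding closed_segment_def by blast
  have affine: "(1 - s) * x + s * y \<le> (1 - t) * x + t * y" if "s \<le> t" "x \<le> y" for s t x y :: real
    using mult_right_mono[of s t "y - x"] that by (simp add: algebra_simps)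
  show ?thesis
    using assms(1) affine[of s t "fst g" "fst p"] affine[of s t "- snd g" "- snd p"]
      affine[of t s "fst g" "fst p"] affine[of t s "- snd g" "- snd p"] st
    unfolding ominus_le_def by (cases "s \<le> t") auto
qed

text \<open>
  If \<open>p\<close> strictly precedes \<open>q\<close>, then \<open>p\<close> precedes the lower end of the segment at \<open>q\<close>, so the whole
  segment at \<open>p\<close> precedes the whole segment at \<open>q\<close>.
\<close>

lemma chain_chain_extension:
  assumes chain: "Complete_Partial_Order.chain ominus_le H" and "closed H"
  shows "Complete_Partial_Order.chain ominus_le (chain_extension H)"
proof (rule chainI)
  let ?g = "\<lambda>p. (chain_L H p, chain_U H p)"
  have less: "ominus_le u v"
    if "p \<in> H" "q \<in> H" "\<not> ominus_le q p" "u \<in> closed_segment (?g p) p" "v \<in> closed_segment (?g q) q" for p q u v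
    using that ominus_le_segment[OF chain_gap(2)[OF assms]] chain_gap(3)[OF assms] ominus_le_trans by meson
  fix u v assume "u \<in> chain_extension H" "v \<in> chain_extension H"
  then obtain p q where pq: "p \<in> H" "u \<in> closed_segment (?g p) p" "q \<in> H" "v \<in> closed_segment (?g q) q"
    unfolding chain_extension_def by blast
  show "ominus_le u v \<or> ominus_le v u"
  proof (cases "p = q")
    case True
    then show ?thesis using pq chain_closed_segment[OF chain_gap(2)[OF assms]] by blast
  next
    case False
    then have "\<not> ominus_le p q \<or> \<not> ominus_le q p" using ominus_le_antisym by blast
    then show ?thesis using less pq by blast
  qed
qed

lemma subset_chain_extension: "H \<subseteq> chain_extension H"
  unfolding chain_extension_def by auto

section \<open>Connectedness of the extension inside the domain\<close>

lemma linear_chain_coord: "linear chain_coord"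
  by (rule linearI) (auto simp: chain_coord_def algebra_simps)

text \<open>
  Every intermediate coordinate \<open>t\<close> is attained on the extension.  Here \<open>h\<close> is the first point of
  \<open>H\<close> at or after \<open>t\<close>, and \<open>g\<close> is the lower end of its segment, hence the last point of \<open>H\<close> before the
  gap, in the limiting sense in which \<open>g\<close> may itself have coordinate \<open>t\<close>.
\<close>

lemma chain_extension_bridge:
  assumes chain: "Complete_Partial_Order.chain ominus_le H" and closed: "closed H"
    and lo: "l \<in> H" "chain_coord l < t" and hi: "u \<in> H" "t < chain_coord u"
  obtains g h k where "g \<in> H" "h \<in> H" "chain_coord g \<le> t" "t \<le> chain_coord h"
    "\<And>q. q \<in> H \<Longrightarrow> chain_coord q < t \<Longrightarrow> chain_coord q \<le> chain_coord g"
    "\<And>q. q \<in> H \<Longrightarrow> t \<le> chain_coord q \<Longrightarrow> chain_coord h \<le> chain_coord q"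
    "k \<in> closed_segment g h" "chain_coord k = t" "k \<in> chain_extension H"
proof -
  define M where "M = {q \<in> H. t \<le> chain_coord q \<and> chain_coord q \<le> chain_coord u}"
  have cont: "continuous_on S chain_coord" for S
    unfolding chain_coord_def by (intro continuous_intros)
  have "bounded M"
    unfolding bounded_any_center[of M u]
  proof (intro exI ballI)
    fix q assume "q \<in> M"
    then show "dist u q \<le> chain_coord u - t"
      using ominus_le_dist[OF ominus_le_chain_coord[OF chain _ hi(1)], of q]
      unfolding M_def by (auto simp: dist_commute)
  qed
  moreover have "closed M"
    unfolding M_def Collect_conj_eq Collect_mem_eq
    by (intro closed_Int closed closed_Collect_le cont continuous_on_const)
  ultimately have "compact M" by (simp add: compact_eq_bounded_closed)
  moreover have "u \<in> M" using hi unfolding M_def by simp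
  then have "M \<noteq> {}" by blast
  ultimately obtain h where h: "h \<in> M" "\<And>q. q \<in> M \<Longrightarrow> chain_coord h \<le> chain_coord q"
    using continuous_attains_inf[OF _ _ cont] by metis
  have h_min: "chain_coord h \<le> chain_coord q" if "q \<in> H" "t \<le> chain_coord q" for q
    using h that unfolding M_def by (cases "chain_coord q \<le> chain_coord u") auto
  have hH: "h \<in> H" "t \<le> chain_coord h" using h(1) unfolding M_def by auto
  define g where "g = (chain_L H h, chain_U H h)"
  have below: "\<not> ominus_le h q" if "chain_coord q < t" for q
    using chain_coord_mono[of h q] that hH(2) by auto
  have gH: "g \<in> H" unfolding g_def by (rule chain_gap(1)[OF chain closed hH(1)])
  have g_max: "chain_coord q \<le> chain_coord g" if "q \<in> H" "chain_coord q < t" for q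
    unfolding g_def
    by (rule chain_coord_mono[OF chain_gap(3)[OF chain closed hH(1) that(1) below[OF that(2)]]])
  have "H - upper_part H h \<subseteq> {q. chain_coord q \<le> t}"
  proof
    fix q assume q: "q \<in> H - upper_part H h"
    then have "q \<in> H" "\<not> ominus_le h q" unfolding upper_part_def by auto
    then have "\<not> chain_coord h \<le> chain_coord q" using ominus_le_chain_coord[OF chain hH(1)] by blast
    then show "q \<in> {q. chain_coord q \<le> t}" using h_min[OF \<open>q \<in> H\<close>] by fastforce
  qed
  moreover have "closed {q. chain_coord q \<le> t}"
    by (intro closed_Collect_le cont continuous_on_const)
  moreover have "g \<in> closure (H - upper_part H h)"
    unfolding g_def
    using lo(1) below[OF lo(2)] by (intro chain_gap(4)[OF chain closed hH(1)]) (auto simp: upper_part_def)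
  ultimately have gt: "chain_coord g \<le> t" using closure_minimal by blast
  then have "t \<in> closed_segment (chain_coord g) (chain_coord h)"
    using hH(2) unfolding closed_segment_eq_real_ivl by auto
  then have "t \<in> chain_coord ` closed_segment g h"
    unfolding closed_segment_linear_image[OF linear_chain_coord] .
  then obtain k where k: "k \<in> closed_segment g h" "chain_coord k = t" by blast
  moreover have "k \<in> chain_extension H"
    using k(1) hH(1) unfolding chain_extension_def g_def by blast
  ultimately show thesis using that gH hH gt g_max h_min by blast
qed

lemma chain_extension_coord_bounds:
  assumes "Complete_Partial_Order.chain ominus_le H" "closed H" "k \<in> chain_extension H"
  obtains g h where "g \<in> H" "h \<in> H" "chain_coord g \<le> chain_coord k" "chain_coord k \<le> chain_coord h"
proof -
  obtain p where p: "p \<in> H" "k \<in> closed_segment (chain_L H p, chain_U H p) p"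
    using assms(3) unfolding chain_extension_def by blast
  show thesis
    using that chain_gap(1)[OF assms(1,2) p(1)] p(1)
      ominus_le_segment[OF chain_gap(2)[OF assms(1,2) p(1)] p(2)] chain_coord_mono by blast
qed

lemma connected_chain:
  assumes chain: "Complete_Partial_Order.chain ominus_le S" and conn: "connected (chain_coord ` S)"
  shows "connected S"
proof -
  define e where "e = inv_into S chain_coord"
  have e: "e (chain_coord p) = p" if "p \<in> S" for p
    unfolding e_def using that chain_coord_inj[OF chain] by (intro inv_into_f_f inj_onI)
  have "dist (e s) (e t) \<le> \<bar>s - t\<bar>" if st: "s \<in> chain_coord ` S" "t \<in> chain_coord ` S" for s t
  proof -
    obtain p q where pq: "p \<in> S" "q \<in> S" "s = chain_coord p" "t = chain_coord q" using st by blast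
    show ?thesis
      using chainD[OF chain pq(1,2)] ominus_le_dist[of p q] ominus_le_dist[of q p]
      unfolding pq(3,4) e[OF pq(1)] e[OF pq(2)] by (auto simp: dist_commute)
  qed
  then have "continuous_on (chain_coord ` S) e"
    unfolding continuous_on_iff dist_real_def by (meson order_le_less_trans abs_minus_commute)
  then have "connected (e ` chain_coord ` S)" using conn by (rule connected_continuous_image)
  also have "e ` chain_coord ` S = S" using e by force
  finally show ?thesis .
qed

text \<open>
  Strong connection is an equivalence relation that is locally constant on \<open>S\<close>: the mixed points of
  \<open>x\<close> and a point \<open>y\<close> in a ball around \<open>x\<close> stay in that ball, so there are direct steps both ways.
\<close>

lemma connected_imp_strongly_connected:
  assumes "connected S" "S \<subseteq> cost_domain c" "open (cost_domain c)"
  shows "strongly_connected_set c S"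
  unfolding strongly_connected_set_def
proof (intro ballI)
  fix a b assume "a \<in> S" "b \<in> S"
  show "strongly_connected_in c S a b"
  proof (rule connected_equivalence_relation[OF assms(1) \<open>a \<in> S\<close> \<open>b \<in> S\<close>])
    fix x assume x: "x \<in> S"
    then obtain d where d: "d > 0" "ball x d \<subseteq> cost_domain c"
      using assms(2,3) by (meson open_contains_ball subsetD)
    have near: "strongly_connected_in c S x y" if y: "y \<in> S \<inter> ball x d" for y
    proof -
      have "dist x (fst y, snd x) < d" "dist x (fst x, snd y) < d"
        using y dist_fst_le[of x y] dist_snd_le[of x y]
          dist_Pair_Pair[of "fst x" "snd x" "fst y" "snd x"]
          dist_Pair_Pair[of "fst x" "snd x" "fst x" "snd y"] by auto
      then have "(fst y, snd x) \<in> cost_domain c" "(fst x, snd y) \<in> cost_domain c" using d(2) by auto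
      then show ?thesis
        using cost_path_edge(1)[of x S y c] cost_path_edge(1)[of y S x c] x y
        unfolding strongly_connected_in_def path_connects_def cost_domain_def by blast
    qed
    show "\<exists>T. openin (top_of_set S) T \<and> x \<in> T \<and> (\<forall>y\<in>T. strongly_connected_in c S x y)"
      using near x d(1) by (intro exI[of _ "S \<inter> ball x d"]) (auto simp: openin_open_Int)
  qed (auto simp: strongly_connected_in_def intro: path_connects_trans)
qed

section \<open>The closure near the boundary of the domain\<close>

text \<open>
  Otherwise \<open>k\<close> is a boundary point of the domain \<open>D\<close>, and it separates \<open>G\<close> into two nonempty parts.
  A path in \<open>G\<close> between the parts has a step \<open>a \<rightarrow> b\<close> across \<open>k\<close>, and the corner \<open>(fst b, snd a)\<close> is in
  \<open>D\<close>.  As \<open>k\<close> is between \<open>a\<close> and \<open>b\<close>, the points \<open>(fst k, snd a)\<close> and \<open>(fst b, snd k)\<close> lie on the two legs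
  that join \<open>a\<close> and \<open>b\<close> to this corner, so they are in \<open>D\<close> by convexity and the
  cost is bounded above near them.  Hence the weights of \<open>a \<rightarrow> g \<rightarrow> b\<close> are unbounded as
  \<open>g \<in> G\<close> tends to \<open>k\<close>.  This covers steps that run forwards and steps that run backwards along
  the chain at once.
\<close>

lemma closure_point_between_in_domain:
  assumes cost: "\<And>p. c p \<noteq> -\<infinity>"
    and domain: "open (cost_domain c)" "convex (cost_domain c)"
    and monotone: "ominus_monotone c"
    and locally_bounded: "\<forall>p\<in>cost_domain c. \<exists>\<delta>>0. (SUP q\<in>ball p \<delta>. c q) < \<infinity>"
    and boundary: "\<forall>p\<in>frontier (cost_domain c). \<forall>s :: nat \<Rightarrow> real \<times> real.
      s \<longlonglongrightarrow> p \<longrightarrow> (\<lambda>k. c (s k)) \<longlonglongrightarrow> \<infinity>"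
    and G: "G \<subseteq> cost_domain c"
    and bounded: "path_bounded c G"
    and connection: "\<forall>S\<^sub>1 S\<^sub>2. S\<^sub>1 \<noteq> {} \<and> S\<^sub>2 \<noteq> {} \<and> S\<^sub>1 \<inter> S\<^sub>2 = {} \<and> S\<^sub>1 \<union> S\<^sub>2 = G \<longrightarrow>
      (\<exists>p\<in>S\<^sub>1. \<exists>q\<in>S\<^sub>2. path_connects c G p q \<or> path_connects c G q p)"
    and k: "k \<in> closure G" and p: "p \<in> G" "chain_coord p \<le> chain_coord k"
    and q: "q \<in> G" "chain_coord k \<le> chain_coord q"
  shows "k \<in> cost_domain c"
proof (rule ccontr)
  assume k_out: "k \<notin> cost_domain c"
  have chain: "Complete_Partial_Order.chain ominus_le (closure G)"
    by (rule chain_closure[OF path_bounded_chain[OF cost monotone G bounded]])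
  have in_closure: "r \<in> closure G" if "r \<in> G" for r using that closure_subset by blast
  \<comment> \<open>A point of \<open>G\<close> with the coordinate of \<open>k\<close> would be \<open>k\<close> itself.\<close>
  have ne: "chain_coord r \<noteq> chain_coord k" if "r \<in> G" for r
    using chain_coord_inj[OF chain in_closure[OF that] k] that G k_out by blast
  let ?S1 = "{r \<in> G. chain_coord r < chain_coord k}" and ?S2 = "{r \<in> G. chain_coord r > chain_coord k}"
  have "p \<in> ?S1" "q \<in> ?S2" using p q ne[of p] ne[of q] by auto
  then have "?S1 \<noteq> {}" "?S2 \<noteq> {}" by blast+
  moreover have "?S1 \<inter> ?S2 = {}" "?S1 \<union> ?S2 = G" using ne by force+
  ultimately obtain s e where se: "path_connects c G s e" "s \<in> G" "e \<in> G"
    "(chain_coord s < chain_coord k) \<noteq> (chain_coord e < chain_coord k)"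
    using connection by (metis (mono_tags, lifting) mem_Collect_eq not_less_iff_gr_or_eq)
  then obtain N r where r: "cost_path c G s e N r" unfolding path_connects_def by blast
  have "\<exists>i\<in>{1..N}. (chain_coord (r i) < chain_coord k) \<noteq> (chain_coord (r (i + 1)) < chain_coord k)"
  proof (rule ccontr)
    assume no_crossing: "\<not> ?thesis"
    have "n \<le> N \<Longrightarrow> (chain_coord (r (n + 1)) < chain_coord k) = (chain_coord (r 1) < chain_coord k)" for n
      using no_crossing by (induction n) auto
    from this[of N] show False using r se(4) unfolding cost_path_def by auto
  qed
  then obtain i where i: "i \<in> {1..N}"
    "(chain_coord (r i) < chain_coord k) \<noteq> (chain_coord (r (i + 1)) < chain_coord k)" by blast
  define a b where "a = r i" and "b = r (i + 1)"
  have ab: "a \<in> G" "b \<in> G" "(fst b, snd a) \<in> cost_domain c"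
    using r i(1) unfolding a_def b_def cost_path_def cost_domain_def by auto
  have between: "ominus_le a k \<and> ominus_le k b \<or> ominus_le b k \<and> ominus_le k a"
    using i(2) ominus_le_chain_coord[OF chain in_closure[OF ab(1)] k] ominus_le_chain_coord[OF chain k in_closure[OF ab(1)]]
      ominus_le_chain_coord[OF chain in_closure[OF ab(2)] k] ominus_le_chain_coord[OF chain k in_closure[OF ab(2)]]
    unfolding a_def[symmetric] b_def[symmetric] by fastforce
  have "(fst k, snd a) \<in> closed_segment a (fst b, snd a)"
  proof -
    have "fst k \<in> closed_segment (fst a) (fst b)"
      using between unfolding ominus_le_def closed_segment_eq_real_ivl by auto
    then show ?thesis using closed_segment_same_snd[of a "(fst b, snd a)"] by simp
  qed
  then have in1: "(fst k, snd a) \<in> cost_domain c"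
    using closed_segment_subset[OF _ ab(3) domain(2)] ab(1) G by blast
  have "(fst b, snd k) \<in> closed_segment (fst b, snd a) b"
  proof -
    have "snd k \<in> closed_segment (snd a) (snd b)"
      using between unfolding ominus_le_def closed_segment_eq_real_ivl by auto
    then show ?thesis using closed_segment_same_fst[of "(fst b, snd a)" b] by simp
  qed
  then have in2: "(fst b, snd k) \<in> cost_domain c"
    using closed_segment_subset[OF ab(3) _ domain(2)] ab(2) G by blast
  have local_bound: "\<exists>M::real. \<forall>\<^sub>F q in nhds z. c q \<le> M" if z: "z \<in> cost_domain c" for z
  proof -
    obtain \<delta> where \<delta>: "\<delta> > 0" "(SUP q\<in>ball z \<delta>. c q) < \<infinity>" using locally_bounded z by blast
    obtain M where M: "(SUP q\<in>ball z \<delta>. c q) \<le> ereal M"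
      using \<delta>(2) by (cases "SUP q\<in>ball z \<delta>. c q") auto
    have "c q \<le> ereal M" if "q \<in> ball z \<delta>" for q
      using SUP_upper[OF that, of c] M by (rule order_trans)
    then have "\<forall>\<^sub>F q in nhds z. c q \<le> M"
      by (rule eventually_mono[OF eventually_nhds_ball[OF \<delta>(1)]])
    then show ?thesis ..
  qed
  obtain M1 M2 :: real where M1: "\<forall>\<^sub>F q in nhds (fst k, snd a). c q \<le> M1"
    and M2: "\<forall>\<^sub>F q in nhds (fst b, snd k). c q \<le> M2"
    using local_bound in1 in2 by meson
  obtain g where g: "\<And>n :: nat. g n \<in> G" "g \<longlonglongrightarrow> k" using k unfolding closure_sequential by blast
  have "k \<in> frontier (cost_domain c)"
    using k k_out closure_mono[OF G] interior_subset unfolding frontier_def by blast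
  then have "(\<lambda>n. c (g n)) \<longlonglongrightarrow> \<infinity>" using boundary g(2) by blast
  then have large: "\<forall>\<^sub>F n in sequentially. ereal B < c (g n)" for B
    unfolding tendsto_PInfty by blast
  have ev1: "\<forall>\<^sub>F n in sequentially. c (fst (g n), snd a) \<le> M1"
    by (rule eventually_compose_filterlim[OF M1]) (intro tendsto_intros g(2))
  have ev2: "\<forall>\<^sub>F n in sequentially. c (fst b, snd (g n)) \<le> M2"
    by (rule eventually_compose_filterlim[OF M2]) (intro tendsto_intros g(2))
  have finite_value: "\<exists>u. c z = ereal u" if "c z < \<infinity>" for z
    using that cost[of z] by (cases "c z") auto
  obtain A where A: "c a = ereal A" using finite_value ab(1) G unfolding cost_domain_def by blast
  have "ereal B \<le> path_sup c G a b" for B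
  proof -
    have "\<forall>\<^sub>F n in sequentially. ereal (B - A + M1 + M2) < c (g n) \<and>
      c (fst (g n), snd a) \<le> M1 \<and> c (fst b, snd (g n)) \<le> M2"
      using large ev1 ev2 by (intro eventually_conj)
    then obtain n where n: "ereal (B - A + M1 + M2) < c (g n)"
      "c (fst (g n), snd a) \<le> M1" "c (fst b, snd (g n)) \<le> M2"
      by (auto dest!: eventually_happens)
    have fin: "c (fst (g n), snd a) < \<infinity>" "c (fst b, snd (g n)) < \<infinity>"
      using n(2,3) by (auto intro: le_less_trans)
    note to_g = cost_path_edge[where c = c, OF ab(1) g(1) fin(1)]
    note from_g = cost_path_edge[where c = c, OF g(1) ab(2) fin(2)]
    have "c (g n) < \<infinity>" using g(1)[of n] G unfolding cost_domain_def by blast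
    then obtain u where u: "c (g n) = ereal u" using finite_value by blast
    obtain v where v: "c (fst (g n), snd a) = ereal v" using finite_value[OF fin(1)] by blast
    obtain w where w: "c (fst b, snd (g n)) = ereal w" using finite_value[OF fin(2)] by blast
    have "ereal B \<le> (c a - c (fst (g n), snd a)) + (c (g n) - c (fst b, snd (g n)))"
      using n unfolding u v w A by simp
    also have "\<dots> \<le> path_sup c G a b"
      using cost_path_append[OF to_g(1) from_g(1)] to_g(2) from_g(2) path_sup_upper by metis
    finally show ?thesis .
  qed
  then have "path_sup c G a b = \<infinity>" by (simp add: ereal_top)
  then show False using bounded ab(1,2) unfolding path_bounded_def by auto
qed

text \<open>
  The ends \<open>g\<close> and \<open>h\<close> of the gap at a coordinate \<open>t\<close> have points of \<open>G\<close> weakly on both sides, because \<open>t\<close> is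
  strictly between the coordinates of two points of the extension and these are enclosed by the closure of \<open>G\<close>.
  So both ends lie in the domain, and by convexity so does the segment between them.
\<close>

lemma connected_chain_extension_in_domain:
  assumes cost: "\<And>p. c p \<noteq> -\<infinity>"
    and domain: "open (cost_domain c)" "convex (cost_domain c)"
    and monotone: "ominus_monotone c"
    and locally_bounded: "\<forall>p\<in>cost_domain c. \<exists>\<delta>>0. (SUP q\<in>ball p \<delta>. c q) < \<infinity>"
    and boundary: "\<forall>p\<in>frontier (cost_domain c). \<forall>s :: nat \<Rightarrow> real \<times> real.
      s \<longlonglongrightarrow> p \<longrightarrow> (\<lambda>k. c (s k)) \<longlonglongrightarrow> \<infinity>"
    and G: "G \<subseteq> cost_domain c"
    and bounded: "path_bounded c G"
    and connection: "\<forall>S\<^sub>1 S\<^sub>2. S\<^sub>1 \<noteq> {} \<and> S\<^sub>2 \<noteq> {} \<and> S\<^sub>1 \<inter> S\<^sub>2 = {} \<and> S\<^sub>1 \<union> S\<^sub>2 = G \<longrightarrow>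
      (\<exists>p\<in>S\<^sub>1. \<exists>q\<in>S\<^sub>2. path_connects c G p q \<or> path_connects c G q p)"
  shows "connected (chain_extension (closure G) \<inter> cost_domain c)"
proof -
  let ?H = "closure G" and ?S = "chain_extension (closure G) \<inter> cost_domain c"
  have chain: "Complete_Partial_Order.chain ominus_le ?H"
    by (rule chain_closure[OF path_bounded_chain[OF cost monotone G bounded]])
  note chain_ext = chain_chain_extension[OF chain closed_closure]
  have approx: "\<exists>q\<in>G. chain_coord q \<in> U" if U: "open U" and h: "h \<in> ?H" "chain_coord h \<in> U" for h U
  proof -
    have "open (chain_coord -` U)"
      using U unfolding chain_coord_def by (intro continuous_open_vimage continuous_intros) auto
    then show ?thesis using h open_Int_closure_eq_empty[of "chain_coord -` U" G] by blast
  qed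
  have "is_interval (chain_coord ` ?S)"
    unfolding is_interval_1
  proof (intro ballI allI impI)
    fix ta tb t assume "ta \<in> chain_coord ` ?S" "tb \<in> chain_coord ` ?S" and t: "ta \<le> t \<and> t \<le> tb"
    then obtain a b where a: "a \<in> ?S" "ta = chain_coord a" and b: "b \<in> ?S" "tb = chain_coord b" by blast
    show "t \<in> chain_coord ` ?S"
    proof (cases "t = ta \<or> t = tb")
      case True
      then show ?thesis using a b by blast
    next
      case False
      then have t: "chain_coord a < t" "t < chain_coord b" using t a(2) b(2) by auto
      obtain l where l: "l \<in> ?H" "chain_coord l < t"
        using chain_extension_coord_bounds[OF chain closed_closure] a(1) t(1) by (metis IntD1 le_less_trans)
      obtain u where u: "u \<in> ?H" "t < chain_coord u"
        using chain_extension_coord_bounds[OF chain closed_closure] b(1) t(2) by (metis IntD1 less_le_trans)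
      obtain g h k where gh: "g \<in> ?H" "h \<in> ?H" "chain_coord g \<le> t" "t \<le> chain_coord h"
        and g_max: "\<And>q. q \<in> ?H \<Longrightarrow> chain_coord q < t \<Longrightarrow> chain_coord q \<le> chain_coord g"
        and h_min: "\<And>q. q \<in> ?H \<Longrightarrow> t \<le> chain_coord q \<Longrightarrow> chain_coord h \<le> chain_coord q"
        and k: "k \<in> closed_segment g h" "chain_coord k = t" "k \<in> chain_extension ?H"
        using chain_extension_bridge[OF chain closed_closure l u] by blast
      obtain p where p: "p \<in> G" "chain_coord p < t"
        using approx[of "{..<t}" l] l by auto
      obtain q where q: "q \<in> G" "t < chain_coord q"
        using approx[of "{t<..}" u] u by auto
      have pg: "chain_coord p \<le> chain_coord g" and hq: "chain_coord h \<le> chain_coord q"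
        using g_max[of p] h_min[of q] p q closure_subset[of G] by auto
      note in_domain = closure_point_between_in_domain[OF cost domain monotone locally_bounded boundary
          G bounded connection]
      have "g \<in> cost_domain c"
        using pg hq gh(3,4) by (intro in_domain[OF gh(1) p(1) _ q(1)]) auto
      moreover have "h \<in> cost_domain c"
        using pg hq gh(3,4) by (intro in_domain[OF gh(2) p(1) _ q(1)]) auto
      ultimately have "k \<in> cost_domain c"
        using closed_segment_subset[OF _ _ domain(2)] k(1) by blast
      then show ?thesis using k(2,3) by blast
    qed
  qed
  then have "connected (chain_coord ` ?S)" by (simp add: is_interval_connected_1)
  then show ?thesis using connected_chain chain_subset[OF chain_ext] by blast
qed

theorem theorem5p21:
  fixes c :: "real \<times> real \<Rightarrow> ereal" and G :: "(real \<times> real) set"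
  assumes cost: "\<And>p. c p \<noteq> -\<infinity>"
    and domain: "cost_domain c \<noteq> {}" "open (cost_domain c)" "convex (cost_domain c)"
      "cost_domain c \<noteq> UNIV"
    and monotone: "ominus_monotone c"
    and locally_bounded:
      "\<forall>p\<in>cost_domain c. \<exists>\<delta>>0. (SUP q\<in>ball p \<delta>. c q) < \<infinity>"
    and boundary: "\<forall>p\<in>frontier (cost_domain c). \<forall>s :: nat \<Rightarrow> real \<times> real.
      s \<longlonglongrightarrow> p \<longrightarrow> (\<lambda>k. c (s k)) \<longlonglongrightarrow> \<infinity>"
    and G: "G \<noteq> {}" "G \<subseteq> cost_domain c"
    and bounded: "path_bounded c G"
    and connection: "\<forall>S\<^sub>1 S\<^sub>2. S\<^sub>1 \<noteq> {} \<and> S\<^sub>2 \<noteq> {} \<and> S\<^sub>1 \<inter> S\<^sub>2 = {} \<and> S\<^sub>1 \<union> S\<^sub>2 = G \<longrightarrow>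
      (\<exists>p\<in>S\<^sub>1. \<exists>q\<in>S\<^sub>2. strongly_connected_in c G p q \<or> unilaterally_connected_in c G p q)"
  shows "Complete_Partial_Order.chain ominus_le (closure G) \<and>
    path_bounded_extension c G (chain_extension (closure G) \<inter> cost_domain c) \<and>
    strongly_connected_set c (chain_extension (closure G) \<inter> cost_domain c) \<and>
    potentiable c G"
proof -
  let ?S = "chain_extension (closure G) \<inter> cost_domain c"
  have chain: "Complete_Partial_Order.chain ominus_le (closure G)"
    by (rule chain_closure[OF path_bounded_chain[OF cost monotone G(2) bounded]])
  have chain_S: "Complete_Partial_Order.chain ominus_le ?S"
    using chain_chain_extension[OF chain closed_closure] by (rule chain_subset) blast
  have sub: "?S \<subseteq> cost_domain c" by blast
  have G_S: "G \<subseteq> ?S" using closure_subset subset_chain_extension G(2) by blast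
  have "\<forall>S\<^sub>1 S\<^sub>2. S\<^sub>1 \<noteq> {} \<and> S\<^sub>2 \<noteq> {} \<and> S\<^sub>1 \<inter> S\<^sub>2 = {} \<and> S\<^sub>1 \<union> S\<^sub>2 = G \<longrightarrow>
      (\<exists>p\<in>S\<^sub>1. \<exists>q\<in>S\<^sub>2. path_connects c G p q \<or> path_connects c G q p)"
  proof (intro allI impI)
    fix S\<^sub>1 S\<^sub>2 assume "S\<^sub>1 \<noteq> {} \<and> S\<^sub>2 \<noteq> {} \<and> S\<^sub>1 \<inter> S\<^sub>2 = {} \<and> S\<^sub>1 \<union> S\<^sub>2 = G"
    then have "\<exists>p\<in>S\<^sub>1. \<exists>q\<in>S\<^sub>2. strongly_connected_in c G p q \<or> unilaterally_connected_in c G p q"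
      by (rule connection[rule_format])
    then show "\<exists>p\<in>S\<^sub>1. \<exists>q\<in>S\<^sub>2. path_connects c G p q \<or> path_connects c G q p"
      unfolding strongly_connected_in_def unilaterally_connected_in_def by blast
  qed
  then have "connected ?S"
    by (rule connected_chain_extension_in_domain[OF cost domain(2,3) monotone locally_bounded boundary
          G(2) bounded])
  then have strong: "strongly_connected_set c ?S"
    using sub domain(2) by (rule connected_imp_strongly_connected)
  have S_bounded: "path_bounded c ?S"
    by (rule strongly_connected_chain_path_bounded[OF cost monotone sub chain_S strong])
  have potential: "potentiable c G"
    using potentiable_strongly_connected[OF cost sub S_bounded strong] G_S by (rule potentiable_subset)
  show ?thesis
    unfolding path_bounded_extension_def by (intro conjI chain sub G_S S_bounded strong potential)
qed

end
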